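(* Let $M$ be a natural number with $M>1$. Then a natural number $m>2$ is prime if and only if $$\prod_{j=1}^{m-1} (M^j + 1) \equiv 1 \pmod{\frac{M^m - 1}{M - 1}}.$$ *)

theory Defs
  imports "HOL-Number_Theory.Number_Theory"
begin

end

theory Submission
  imports Defs "HOL-Computational_Algebra.Polynomial"
begin

text \<open>
  For odd \<open>m\<close> and \<open>d dvd m\<close>, doubling modulo \<open>m\<close> permutes the \<open>j\<close> with \<open>gcd j d = g\<close>. Since
  \<open>M ^ (2 * j) - 1 = (M ^ j + 1) * (M ^ j - 1)\<close>, and \<open>(M ^ j - 1) / (M ^ g - 1)\<close> is invertible modulo
  \<open>(M ^ d - 1) / (M ^ g - 1)\<close>, the product of the \<open>M ^ j + 1\<close> over these \<open>j\<close> is \<open>1\<close> for the latter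
  modulus. For prime \<open>m = d\<close> and \<open>g = 1\<close> this is the congruence.

  Conversely, if \<open>m\<close> is even, then \<open>M ^ (m / 2) + 1\<close> divides both the product and the modulus. If \<open>m\<close>
  is odd and composite with least prime factor \<open>p\<close>, put \<open>d = m / p\<close>. The value \<open>\<Phi>\<close> at \<open>M\<close> of the
  \<open>d\<close>-th cyclotomic polynomial divides all \<open>(M ^ d - 1) / (M ^ g - 1)\<close> with \<open>g\<close> a proper divisor of
  \<open>d\<close>, so the product is \<open>2 ^ (p - 1)\<close> modulo \<open>\<Phi>\<close>, and \<open>\<Phi>\<close> would divide \<open>2 ^ (p - 1) - 1\<close>. But
  \<open>\<Phi> > (M - 1) ^ totient d \<ge> (M - 1) ^ (p - 1)\<close>, which is impossible for \<open>M \<ge> 3\<close>; for \<open>M = 2\<close>,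
  \<open>\<Phi>\<close> also divides \<open>2 ^ d - 1\<close>, which is coprime to \<open>2 ^ (p - 1) - 1\<close>, so \<open>\<Phi> = 1\<close>, again
  impossible.
\<close>

section \<open>Divisibility among the numbers \<open>M ^ a - 1\<close>\<close>

lemma dvd_power_minus_one_iff:
  fixes M a t :: nat
  assumes "M > 0"
  shows "t dvd M ^ a - 1 \<longleftrightarrow> ord t M dvd a"
proof -
  have "t dvd M ^ a - 1 \<longleftrightarrow> [M ^ a = 1] (mod t)"
    using assms by (intro cong_altdef_nat[symmetric]) auto
  thus ?thesis
    \<comment> \<open>If \<open>t\<close> and \<open>M\<close> are not coprime,
      \<open>ord t M\<close> is 0 and both sides say \<open>a = 0\<close>.\<close>
    by (simp only: ord_divides)
qed

lemma power_minus_one_dvd_power_minus_one: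
  fixes M a b :: nat
  assumes "M > 0" "a dvd b"
  shows "M ^ a - 1 dvd M ^ b - 1"
  using assms dvd_power_minus_one_iff[of M "M ^ a - 1"] by (meson dvd_refl dvd_trans)

text \<open>A common divisor \<open>t\<close> has \<open>ord t M\<close> dividing both exponents,
  hence their gcd.\<close>

lemma gcd_power_minus_one:
  fixes M a b :: nat
  assumes "M > 0"
  shows "gcd (M ^ a - 1) (M ^ b - 1) = M ^ gcd a b - 1"
proof (rule dvd_antisym)
  show "gcd (M ^ a - 1) (M ^ b - 1) dvd M ^ gcd a b - 1"
    using assms dvd_power_minus_one_iff by (metis gcd_dvd1 gcd_dvd2 gcd_greatest)
  show "M ^ gcd a b - 1 dvd gcd (M ^ a - 1) (M ^ b - 1)"
    using assms by (intro gcd_greatest power_minus_one_dvd_power_minus_one) auto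
qed

section \<open>The product over one gcd class\<close>

lemma prod_power_plus_one_gcd_class:
  fixes M m d g :: nat
  assumes M: "M > 1" and m: "odd m" and dm: "d dvd m" and gd: "g dvd d"
  shows "[(\<Prod>j\<in>{j\<in>{0<..<m}. gcd j d = g}. M ^ j + 1) = 1] (mod ((M ^ d - 1) div (M ^ g - 1)))"
proof -
  define S where "S = {j\<in>{0<..<m}. gcd j d = g}"
  define h where "h j = (M ^ j - 1) div (M ^ g - 1)" for j
  have m0: "m > 0" using m by (auto intro: Nat.gr0I)
  have d0: "d > 0" using dm m0 by (auto intro: Nat.gr0I)
  have g0: "g > 0" using gd d0 by (auto intro: Nat.gr0I)
  have oddd: "odd d" using m dm by auto
  have Mg: "M ^ g - 1 > 0" using one_less_power[OF M g0] by simp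
  have finS: "finite S" by (simp add: S_def)
  have h: "h a * (M ^ g - 1) = M ^ a - 1" if "g dvd a" for a
    unfolding h_def using M that by (intro dvd_div_mult_self power_minus_one_dvd_power_minus_one) auto
  have gS: "g dvd j" if "j \<in> S" for j
    using that by (auto simp: S_def)
  have double: "(M ^ j + 1) * h j = h (2 * j)" if "g dvd j" for j
  proof -
    have "(M ^ j + 1) * h j * (M ^ g - 1) = (M ^ j + 1) * (M ^ j - 1)"
      by (simp only: mult.assoc h[OF that])
    also have "\<dots> = M ^ (2 * j) - 1"
      by (simp add: mult_2 power_add diff_mult_distrib2)
    also have "\<dots> = h (2 * j) * (M ^ g - 1)"
      using h[of "2 * j"] that by simp
    finally show ?thesis using Mg by simp
  qed
  \<comment> \<open>Modulo \<open>h d\<close>, only the residue of the index modulo \<open>d\<close>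
    matters, since \<open>M ^ (b + d * k) - 1\<close> is
    \<open>M ^ b * (M ^ (d * k) - 1) + (M ^ b - 1)\<close>.\<close>
  have period: "[h (b + d * k) = h b] (mod h d)" if "g dvd b" for b k
  proof -
    have gdk: "g dvd d * k" using gd by simp
    have M1: "M ^ b \<ge> 1" "M ^ (d * k) \<ge> 1" using M by auto
    have "(M ^ b * h (d * k) + h b) * (M ^ g - 1) = M ^ b * (M ^ (d * k) - 1) + (M ^ b - 1)"
      using h[OF that] h[OF gdk] by (simp add: algebra_simps)
    also have "\<dots> = M ^ (b + d * k) - 1"
    proof -
      have "M ^ b \<le> M ^ b * M ^ (d * k)" using M by simp
      thus ?thesis using M1 by (simp add: power_add diff_mult_distrib2)
    qed
    also have "\<dots> = h (b + d * k) * (M ^ g - 1)"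
      using h[of "b + d * k"] that gdk by simp
    finally have eq: "h (b + d * k) = M ^ b * h (d * k) + h b"
      using Mg by simp
    have "h d dvd h (d * k)"
      unfolding h_def using M gd gdk
      by (intro div_dvd_div[THEN iffD2] power_minus_one_dvd_power_minus_one) auto
    hence "[M ^ b * h (d * k) = 0] (mod h d)" by (simp add: cong_0_iff)
    hence "[M ^ b * h (d * k) + h b = 0 + h b] (mod h d)" by (intro cong_add cong_refl)
    thus ?thesis by (simp add: eq)
  qed
  \<comment> \<open>On \<open>S\<close> the divisor \<open>M ^ g - 1\<close> is exactly the gcd of
    \<open>M ^ j - 1\<close> and \<open>M ^ d - 1\<close>, so the cofactors are coprime.\<close>
  have cop: "coprime (h j) (h d)" if "j \<in> S" for j
  proof -
    have "gcd (M ^ j - 1) (M ^ d - 1) = M ^ g - 1"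
      using gcd_power_minus_one[of M j d] M that by (simp add: S_def)
    moreover have "M ^ d - 1 \<noteq> 0" using one_less_power[OF M d0] by simp
    ultimately show ?thesis
      unfolding h_def using div_gcd_coprime[of "M ^ j - 1" "M ^ d - 1"] by simp
  qed
  have gcd_double: "gcd (2 * j mod m) d = gcd j d" for j
  proof -
    have "gcd (2 * j mod m) d = gcd d (2 * j mod m mod d)" by (rule gcd_red_nat)
    also have "\<dots> = gcd (2 * j) d" by (simp only: mod_mod_cancel[OF dm] gcd_red_nat[of "2 * j" d])
    also have "\<dots> = gcd j d" using oddd by (simp add: gcd_mult_left_left_cancel coprime_left_2_iff_odd)
    finally show ?thesis .
  qed
  have inj: "inj_on (\<lambda>j. 2 * j mod m) S"
  proof (rule inj_onI)
    fix x y assume xy: "x \<in> S" "y \<in> S" "2 * x mod m = 2 * y mod m"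
    hence "[2 * x = 2 * y] (mod m)" by (simp add: cong_def)
    hence "[x = y] (mod m)" using m by (simp add: cong_mult_lcancel_nat)
    thus "x = y" using xy by (auto simp: S_def cong_def)
  qed
  have "(\<lambda>j. 2 * j mod m) ` S \<subseteq> S"
  proof
    fix x assume "x \<in> (\<lambda>j. 2 * j mod m) ` S"
    then obtain j where j: "j \<in> S" "x = 2 * j mod m" by auto
    have "\<not> m dvd 2 * j"
    proof
      assume "m dvd 2 * j"
      hence "m dvd j" using m by (simp add: coprime_dvd_mult_right_iff)
      thus False using j by (auto simp: S_def dest: dvd_imp_le)
    qed
    hence "x \<noteq> 0" using j by (simp add: mod_eq_0_iff_dvd)
    thus "x \<in> S" using j m0 gcd_double[of j] by (auto simp: S_def)
  qed
  hence perm: "bij_betw (\<lambda>j. 2 * j mod m) S S"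
    using inj finS by (simp add: bij_betw_def endo_inj_surj)
  have "(\<Prod>j\<in>S. M ^ j + 1) * (\<Prod>j\<in>S. h j) = (\<Prod>j\<in>S. h (2 * j))"
    unfolding prod.distrib[symmetric] by (intro prod.cong refl double gS)
  also have "[\<dots> = (\<Prod>j\<in>S. h (2 * j mod m))] (mod h d)"
  proof (rule cong_prod)
    fix j assume j: "j \<in> S"
    \<comment> \<open>Reduction modulo \<open>m\<close> shifts the index by a multiple of
      \<open>d\<close>, so \<open>period\<close> applies.\<close>
    obtain c where c: "m = d * c" using dm by auto
    have "g dvd 2 * j mod m"
      using gS[OF j] gd dm by (meson dvd_mod dvd_mult dvd_trans)
    from period[OF this, of "c * (2 * j div m)"] show "[h (2 * j) = h (2 * j mod m)] (mod h d)"
      by (metis c mod_mult_div_eq mult.assoc)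
  qed
  also have "(\<Prod>j\<in>S. h (2 * j mod m)) = (\<Prod>j\<in>S. h j)"
    by (rule prod.reindex_bij_betw[OF perm])
  finally have "[(\<Prod>j\<in>S. M ^ j + 1) * (\<Prod>j\<in>S. h j) = 1 * (\<Prod>j\<in>S. h j)] (mod h d)"
    by simp
  moreover have "coprime (\<Prod>j\<in>S. h j) (h d)"
    by (intro prod_coprime_left cop)
  ultimately show ?thesis
    by (simp only: cong_mult_rcancel_nat S_def[symmetric]) (simp add: h_def)
qed

section \<open>Cyclotomic values and the product modulo them\<close>

text \<open>
  The value at \<open>M\<close> of the \<open>n\<close>-th cyclotomic polynomial, without the polynomial: a prime power \<open>t\<close>
  divides \<open>M ^ n - 1\<close> iff \<open>ord t M dvd n\<close>, so sorting the prime powers dividing \<open>M ^ n - 1\<close> by order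
  gives the factorisation of \<open>M ^ n - 1\<close> over the divisors of \<open>n\<close>. Meaningful only for \<open>n > 0\<close>, as
  \<open>ord t M = 0\<close> if \<open>t\<close> and \<open>M\<close> are not coprime.
\<close>
definition cyclotomic_value :: "nat \<Rightarrow> nat \<Rightarrow> nat" where
  "cyclotomic_value M n = (\<Prod>t | primepow t \<and> ord t M = n. aprimedivisor t)"

text \<open>A prime \<open>p\<close> occurs once for each power \<open>p ^ i\<close> with
  \<open>i > 0\<close> dividing \<open>n\<close>, that is, with its multiplicity. The proof takes
  logarithms and uses the divisor sum of the von Mangoldt function.\<close>

lemma prod_aprimedivisor_primepow_factors:
  fixes n :: nat
  assumes "n > 0"
  shows "(\<Prod>t\<in>primepow_factors n. aprimedivisor t) = n"
proof -
  have pos: "aprimedivisor t > 0" if "t \<in> primepow_factors n" for t :: nat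
    using that by (auto simp: primepow_factors_def intro!: aprimedivisor_pos_nat dest: primepow_gt_Suc_0)
  have "ln (real (\<Prod>t\<in>primepow_factors n. aprimedivisor t)) =
          (\<Sum>t\<in>primepow_factors n. ln (real (aprimedivisor t)))"
    using assms pos by (simp add: ln_prod finite_primepow_factors)
  also have "\<dots> = (\<Sum>t | t dvd n. mangoldt t)"
    using assms
    by (intro sum.mono_neutral_cong_left) (auto simp: primepow_factors_def mangoldt_def)
  also have "\<dots> = ln (real n)"
    using mangoldt_sum[of n, where ?'a = real] assms by simp
  finally have "real (\<Prod>t\<in>primepow_factors n. aprimedivisor t) = real n"
    using assms pos by (subst (asm) ln_inj_iff) (auto intro!: prod_pos)
  thus ?thesis by (simp only: of_nat_eq_iff)
qed

lemma prod_cyclotomic_value: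
  fixes M n :: nat
  assumes M: "M > 1" and n: "n > 0"
  shows "(\<Prod>e | e dvd n. cyclotomic_value M e) = M ^ n - 1"
proof -
  have pos: "M ^ n - 1 > 0" using one_less_power[OF M n] by simp
  have mem: "t \<in> primepow_factors (M ^ n - 1) \<longleftrightarrow> primepow t \<and> ord t M dvd n" for t
    using M dvd_power_minus_one_iff[of M t n] by (auto simp: primepow_factors_def)
  have "(\<Prod>e | e dvd n. cyclotomic_value M e) =
        (\<Prod>e | e dvd n. \<Prod>t\<in>{t\<in>primepow_factors (M ^ n - 1). ord t M = e}. aprimedivisor t)"
    unfolding cyclotomic_value_def by (intro prod.cong refl) (auto simp: mem simp del: One_nat_def)
  also have "\<dots> = (\<Prod>t\<in>primepow_factors (M ^ n - 1). aprimedivisor t)"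
    using n pos by (intro prod.group) (auto simp: mem finite_primepow_factors simp del: One_nat_def)
  also have "\<dots> = M ^ n - 1"
    by (rule prod_aprimedivisor_primepow_factors[OF pos])
  finally show ?thesis .
qed

text \<open>The quotient is the product of the values at those divisors of \<open>n\<close> that do
  not divide \<open>g\<close>, and \<open>n\<close> is one of them.\<close>

lemma cyclotomic_value_dvd:
  fixes M n g :: nat
  assumes M: "M > 1" and n: "n > 0" and g: "g dvd n" "g \<noteq> n"
  shows "cyclotomic_value M n dvd (M ^ n - 1) div (M ^ g - 1)"
proof -
  have g0: "g > 0" using g n by (auto intro: Nat.gr0I)
  have fin: "finite {e. e dvd n}" using n by simp
  have Mg: "M ^ g - 1 > 0" using one_less_power[OF M g0] by simp
  have "M ^ n - 1 = (\<Prod>e\<in>{e. e dvd n} - {e. e dvd g}. cyclotomic_value M e) * (M ^ g - 1)"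
    unfolding prod_cyclotomic_value[OF M n, symmetric] prod_cyclotomic_value[OF M g0, symmetric]
    using g by (intro prod.subset_diff fin) (auto intro: dvd_trans)
  hence "(M ^ n - 1) div (M ^ g - 1) = (\<Prod>e\<in>{e. e dvd n} - {e. e dvd g}. cyclotomic_value M e)"
    using Mg by simp
  moreover have "cyclotomic_value M n dvd \<dots>"
    using fin g by (intro dvd_prodI) (auto dest: dvd_antisym)
  ultimately show ?thesis by simp
qed

text \<open>Split by \<open>g = gcd j d\<close>. Each class with \<open>g < d\<close> contributes 1;
  in the class \<open>g = d\<close> every \<open>M ^ j\<close> is 1, so every factor is 2.\<close>

lemma prod_power_plus_one_cong_cyclotomic_value:
  fixes M m d :: nat
  assumes M: "M > 1" and m: "odd m" and dm: "d dvd m"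
  shows "[(\<Prod>j\<in>{0<..<m}. M ^ j + 1) = 2 ^ (m div d - 1)] (mod cyclotomic_value M d)"
proof -
  define P where "P g = (\<Prod>j\<in>{j\<in>{0<..<m}. gcd j d = g}. M ^ j + 1)" for g
  have m0: "m > 0" using m by (auto intro: Nat.gr0I)
  have d0: "d > 0" using dm m0 by (auto intro: Nat.gr0I)
  have fin: "finite {g. g dvd d}" using d0 by simp
  have "(\<Prod>j\<in>{0<..<m}. M ^ j + 1) = (\<Prod>g | g dvd d. P g)"
    unfolding P_def by (rule prod.group[symmetric]) (use fin in auto)
  also have "\<dots> = P d * (\<Prod>g\<in>{g. g dvd d} - {d}. P g)"
    using fin by (simp add: prod.remove)
  also have "[\<dots> = 2 ^ (m div d - 1) * (\<Prod>g\<in>{g. g dvd d} - {d}. 1)] (mod cyclotomic_value M d)"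
  proof (intro cong_mult cong_prod)
    fix g assume g: "g \<in> {g. g dvd d} - {d}"
    show "[P g = 1] (mod cyclotomic_value M d)"
      unfolding P_def using g
      by (intro cong_dvd_modulus_nat[OF prod_power_plus_one_gcd_class[OF M m dm]
            cyclotomic_value_dvd[OF M d0]]) auto
  next
    have cv: "cyclotomic_value M d dvd M ^ d - 1"
      unfolding prod_cyclotomic_value[OF M d0, symmetric] using fin by (intro dvd_prodI) auto
    have "[P d = (\<Prod>j\<in>{j\<in>{0<..<m}. gcd j d = d}. 1 + 1)] (mod cyclotomic_value M d)"
      unfolding P_def
    proof (intro cong_prod cong_add cong_refl)
      fix j assume "j \<in> {j\<in>{0<..<m}. gcd j d = d}"
      hence "d dvd j" by (metis (mono_tags, lifting) gcd_dvd1 mem_Collect_eq)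
      hence "cyclotomic_value M d dvd M ^ j - 1"
        using cv M power_minus_one_dvd_power_minus_one[of M d j] by (auto intro: dvd_trans)
      thus "[M ^ j = 1] (mod cyclotomic_value M d)"
        using M by (simp add: dvd_power_minus_one_iff ord_divides del: One_nat_def)
    qed
    \<comment> \<open>The multiples \<open>0\<close> and \<open>m\<close> of \<open>d\<close> fall
      outside the range, hence the \<open>- 1\<close> in the exponent.\<close>
    moreover have "{j\<in>{0<..<m}. gcd j d = d} = (\<lambda>k. d * k) ` {0<..<m div d}"
    proof -
      obtain c where c: "m = d * c" using dm by auto
      have "gcd j d = d \<longleftrightarrow> d dvd j" for j by (metis gcd_dvd1 gcd_nat.absorb2)
      thus ?thesis using d0 by (auto simp: c image_iff elim!: dvdE)
    qed
    hence "card {j\<in>{0<..<m}. gcd j d = d} = m div d - 1"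
      using d0 by (simp add: card_image inj_on_def)
    ultimately show "[P d = 2 ^ (m div d - 1)] (mod cyclotomic_value M d)"
      by (simp add: numeral_2_eq_2)
  qed
  finally show ?thesis by simp
qed

section \<open>Lower bound for cyclotomic values via roots of unity\<close>

lemma prod_roots_of_unity:
  fixes x :: complex
  assumes n: "n > 0"
  shows "(\<Prod>k\<in>{0<..n}. x - cis (2 * pi * (real k / real n))) = x ^ n - 1"
proof -
  define A where "A = {z::complex. z ^ n = 1}"
  have fin: "finite A" unfolding A_def using n by (intro finite_roots_unity) auto
  define p where "p = (\<Prod>z\<in>A. [:- z, 1:])"
  define q where "q = Polynomial.monom 1 n - (1 :: complex poly)"
  have card: "card A = n" unfolding A_def by (rule card_roots_unity_eq[OF n])
  have degp: "Polynomial.degree p = n"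
    unfolding p_def using card by (subst degree_prod_eq_sum_degree) auto
  have lp: "lead_coeff p = 1"
    unfolding p_def by (simp add: lead_coeff_prod)
  \<comment> \<open>Both are monic of degree \<open>n\<close> and vanish at the \<open>n\<close>
    points of \<open>A\<close>.\<close>
  have "p = q"
  proof (rule poly_eqI_degree_lead_coeff[of _ n _ A])
    show "poly.coeff p n = poly.coeff q n" using lp degp n by (simp add: q_def)
    show "Polynomial.degree q \<le> n" unfolding q_def by (intro degree_diff_le) (auto simp: degree_monom_eq)
    show "poly p z = poly q z" if "z \<in> A" for z
      using fin that by (auto simp: p_def q_def A_def poly_prod poly_monom)
  qed (use card degp in auto)
  \<comment> \<open>The indices \<open>k = n\<close> and \<open>k = 0\<close> give the same root
    1.\<close>
  have "(\<Prod>k\<in>{0<..n}. x - cis (2 * pi * (real k / real n))) =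
        (\<Prod>k\<in>{..<n}. x - cis (2 * pi * real k / real n))"
  proof -
    have "{0<..n} = insert n {0<..<n}" "{..<n} = insert 0 {0<..<n}" using n by auto
    thus ?thesis using n by simp
  qed
  also have "\<dots> = (\<Prod>z\<in>A. x - z)"
    unfolding A_def by (rule prod.reindex_bij_betw[OF bij_betw_roots_unity[OF n]])
  also have "\<dots> = poly p x" by (simp add: p_def poly_prod)
  also have "\<dots> = x ^ n - 1" by (simp add: \<open>p = q\<close> q_def poly_monom)
  finally show ?thesis .
qed

text \<open>Each \<open>k / n\<close> has a unique form in lowest terms, with denominator
  \<open>n div gcd k n\<close>. This sorts the \<open>n\<close>-th roots of unity by exact
  order.\<close>

lemma prod_fractions_by_denominator:
  fixes f :: "real \<Rightarrow> 'a :: comm_monoid_mult"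
  assumes n: "n > 0"
  shows "(\<Prod>e | e dvd n. \<Prod>k\<in>totatives e. f (real k / real e)) = (\<Prod>k\<in>{0<..n}. f (real k / real n))"
proof -
  have fin: "finite {e. e dvd n}" using n by simp
  have "(\<Prod>k\<in>{0<..n}. f (real k / real n)) =
        (\<Prod>g | g dvd n. \<Prod>k\<in>{k\<in>{0<..n}. gcd k n = g}. f (real k / real n))"
    by (rule prod.group[symmetric]) (use fin in auto)
  also have "\<dots> = (\<Prod>g | g dvd n. \<Prod>k\<in>totatives (n div g). f (real k / real (n div g)))"
  proof (rule prod.cong[OF refl])
    fix g assume "g \<in> {g. g dvd n}"
    hence g: "g dvd n" by simp
    from g have g0: "g > 0" using n by (auto intro: Nat.gr0I)
    have "(\<Prod>k\<in>{k\<in>{0<..n}. gcd k n = g}. f (real k / real n)) =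
          (\<Prod>k\<in>totatives (n div g). f (real (k * g) / real n))"
      by (rule prod.reindex_bij_betw[OF bij_betw_totatives_gcd_eq[OF g n], symmetric])
    also have "\<dots> = (\<Prod>k\<in>totatives (n div g). f (real k / real (n div g)))"
      using g g0 by (intro prod.cong refl) (simp add: real_of_nat_div field_simps)
    finally show "(\<Prod>k\<in>{k\<in>{0<..n}. gcd k n = g}. f (real k / real n)) =
          (\<Prod>k\<in>totatives (n div g). f (real k / real (n div g)))" .
  qed
  also have "\<dots> = (\<Prod>e | e dvd n. \<Prod>k\<in>totatives e. f (real k / real e))"
    by (rule prod.reindex_bij_witness[of _ "\<lambda>e. n div e" "\<lambda>e. n div e"]) (use n in \<open>auto elim!: dvdE\<close>)
  finally show ?thesis ..
qed

text \<open>Over the divisors of \<open>n\<close>, both sides multiply to \<open>M ^ n - 1\<close>;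
  by induction the factors for proper divisors agree and cancel.\<close>

lemma cyclotomic_value_eq_prod_norm:
  fixes M n :: nat
  assumes M: "M > 1" and n: "n > 0"
  shows "real (cyclotomic_value M n) =
           (\<Prod>k\<in>totatives n. norm (of_nat M - cis (2 * pi * (real k / real n))))"
  using n
proof (induction n rule: less_induct)
  case (less n)
  define F where "F e = (\<Prod>k\<in>totatives e. norm (of_nat M - cis (2 * pi * (real k / real e))))" for e
  have fin: "finite {e. e dvd n}" using less.prems by simp
  have M1: "M ^ n > 1" using one_less_power[OF M less.prems] .
  have "(\<Prod>e | e dvd n. F e) = norm (of_nat M ^ n - 1 :: complex)"
    unfolding F_def prod_norm prod_roots_of_unity[OF less.prems, symmetric]
    by (simp only: prod_fractions_by_denominator[OF less.prems,
          of "\<lambda>t. of_nat M - cis (2 * pi * t)"])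
  also have "(of_nat M ^ n - 1 :: complex) = of_nat (M ^ n - 1)"
    using M1 by (simp add: of_nat_diff)
  also have "norm \<dots> = real (\<Prod>e | e dvd n. cyclotomic_value M e)"
    using prod_cyclotomic_value[OF M less.prems] by simp
  also have "\<dots> = real (cyclotomic_value M n) * (\<Prod>e\<in>{e. e dvd n} - {n}. real (cyclotomic_value M e))"
    using fin by (simp add: prod.remove[of _ n])
  also have "(\<Prod>e\<in>{e. e dvd n} - {n}. real (cyclotomic_value M e)) = (\<Prod>e\<in>{e. e dvd n} - {n}. F e)"
  proof (intro prod.cong refl)
    fix e assume "e \<in> {e. e dvd n} - {n}"
    hence "e < n" "e > 0" using less.prems by (auto dest: dvd_imp_le intro: Nat.gr0I)
    thus "real (cyclotomic_value M e) = F e" unfolding F_def by (rule less.IH)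
  qed
  also have "(\<Prod>e | e dvd n. F e) = F n * (\<Prod>e\<in>{e. e dvd n} - {n}. F e)"
    using fin by (simp add: prod.remove)
  finally have "F n * (\<Prod>e\<in>{e. e dvd n} - {n}. F e) =
      real (cyclotomic_value M n) * (\<Prod>e\<in>{e. e dvd n} - {n}. F e)" .
  \<comment> \<open>Cancellation needs this: \<open>M > 1\<close> is off the unit circle.\<close>
  moreover have "F e \<noteq> 0" for e
  proof -
    have "of_nat M \<noteq> cis t" for t
      using M by (metis norm_cis norm_of_nat of_nat_1 of_nat_eq_iff less_irrefl)
    thus ?thesis by (simp add: F_def)
  qed
  ultimately have "F n = real (cyclotomic_value M n)"
    using fin by simp
  thus ?case by (simp add: F_def)
qed

text \<open>Each factor is at least its real part \<open>M - cos\<close>, where the cosine is below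
  1 because \<open>k / n\<close> is not an integer. At \<open>n = 1\<close> equality would
  hold.\<close>

lemma cyclotomic_value_gt:
  fixes M n :: nat
  assumes M: "M > 1" and n: "n > 1"
  shows "cyclotomic_value M n > (M - 1) ^ totient n"
proof -
  have gt: "norm (of_nat M - cis (2 * pi * (real k / real n))) > real (M - 1)"
    if k: "k \<in> totatives n" for k
  proof -
    have k': "k > 0" "k < n" using k totatives_less[of k n] n by (auto simp: in_totatives_iff)
    have "cos (2 * pi * (real k / real n)) \<noteq> 1"
    proof
      assume "cos (2 * pi * (real k / real n)) = 1"
      then obtain i :: int where "2 * pi * (real k / real n) = of_int i * 2 * pi"
        by (auto simp: cos_one_2pi_int)
      hence "real k = of_int i * real n" using n by (simp add: field_simps)
      hence "int k = i * int n" by (metis of_int_eq_iff of_int_mult of_int_of_nat_eq)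
      hence "n dvd k" by (metis dvd_triv_right int_dvd_int_iff)
      thus False using k' by (auto dest: dvd_imp_le)
    qed
    hence "cos (2 * pi * (real k / real n)) < 1"
      using cos_le_one[of "2 * pi * (real k / real n)"] by linarith
    hence "real (M - 1) < Re (of_nat M - cis (2 * pi * (real k / real n)))"
      using M by (simp add: of_nat_diff)
    also have "\<dots> \<le> norm (of_nat M - cis (2 * pi * (real k / real n)))"
      by (rule complex_Re_le_cmod)
    finally show ?thesis .
  qed
  have "real ((M - 1) ^ totient n) = (\<Prod>k\<in>totatives n. real (M - 1))"
    by (simp add: totient_def)
  also have "\<dots> < (\<Prod>k\<in>totatives n. norm (of_nat M - cis (2 * pi * (real k / real n))))"
  proof (rule prod_mono_strict[of 1])
    show "1 \<in> totatives n" using n by simp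
    show "real (M - 1) < norm (of_nat M - cis (2 * pi * (real 1 / real n)))"
      using gt[of 1] n by simp
    show "0 \<le> real (M - 1) \<and> real (M - 1) \<le> norm (of_nat M - cis (2 * pi * (real k / real n)))"
      if "k \<in> totatives n" for k using gt[OF that] by simp
    show "0 < norm (of_nat M - cis (2 * pi * (real k / real n)))"
      if "k \<in> totatives n" for k using le_less_trans[OF of_nat_0_le_iff gt[OF that]] .
  qed simp
  also have "\<dots> = real (cyclotomic_value M n)"
    using n by (intro cyclotomic_value_eq_prod_norm[OF M, symmetric]) auto
  finally show ?thesis by (simp only: of_nat_less_iff)
qed

section \<open>The primality criterion in both directions\<close>

theorem theorem2:
  fixes M m :: nat
  assumes "M > 1" and "m > 2"
  shows "prime m \<longleftrightarrow> [(\<Prod>j=1..m-1. M ^ j + 1) = 1] (mod ((M ^ m - 1) div (M - 1)))"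
proof
  note M = \<open>M > 1\<close>
  have range: "{1..m-1} = {0<..<m}" using assms by auto
  assume p: "prime m"
  hence "odd m" using assms by (simp add: prime_odd_nat)
  have "{j\<in>{0<..<m}. gcd j m = 1} = {0<..<m}"
  proof -
    have "coprime j m" if "0 < j" "j < m" for j
      using that totatives_prime[OF p] in_totatives_iff[of j m] by simp
    thus ?thesis by auto
  qed
  with prod_power_plus_one_gcd_class[OF M \<open>odd m\<close> dvd_refl, of 1]
  show "[(\<Prod>j=1..m-1. M ^ j + 1) = 1] (mod ((M ^ m - 1) div (M - 1)))"
    by (simp only: range) simp
next
  note M = \<open>M > 1\<close>
  have range: "{1..m-1} = {0<..<m}" using assms by auto
  assume "[(\<Prod>j=1..m-1. M ^ j + 1) = 1] (mod ((M ^ m - 1) div (M - 1)))"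
  hence cong: "[(\<Prod>j\<in>{0<..<m}. M ^ j + 1) = 1] (mod ((M ^ m - 1) div (M - 1)))"
    by (simp only: range)
  show "prime m"
  proof (rule ccontr)
    assume np: "\<not> prime m"
    have "odd m"
    proof
      assume "even m"
      then obtain k where k: "m = 2 * k" by auto
      have "(M ^ k + 1) * (M ^ k - 1) = M ^ m - 1"
        by (simp add: k mult_2 power_add diff_mult_distrib2)
      moreover have "M - 1 dvd M ^ k - 1"
        using power_minus_one_dvd_power_minus_one[of M 1 k] M by simp
      ultimately have "M ^ k + 1 dvd (M ^ m - 1) div (M - 1)"
        by (metis div_mult_swap dvd_triv_left)
      with cong have "[(\<Prod>j\<in>{0<..<m}. M ^ j + 1) = 1] (mod M ^ k + 1)"
        by (rule cong_dvd_modulus_nat)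
      moreover have "M ^ k + 1 dvd (\<Prod>j\<in>{0<..<m}. M ^ j + 1)"
        using assms by (intro dvd_prodI) (auto simp: k)
      ultimately have "M ^ k + 1 dvd 1" using cong_dvd_iff by blast
      thus False using M by simp
    qed
    define p where "p = (LEAST p. prime p \<and> p dvd m)"
    have "\<exists>p. prime p \<and> p dvd m" using assms by (intro prime_factor_nat) auto
    hence p: "prime p" "p dvd m" unfolding p_def by (metis (mono_tags, lifting) LeastI_ex)+
    have p_least: "p \<le> q" if "prime q" "q dvd m" for q
      unfolding p_def using that by (intro Least_le) auto
    define d where "d = m div p"
    have m_eq: "m = p * d" using p by (simp add: d_def)
    have "d \<noteq> 0" using m_eq assms by (intro notI) simp
    moreover have "d \<noteq> 1" using m_eq p np by auto
    ultimately have d: "d > 1" by simp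
    have dm: "d dvd m" by (simp add: m_eq)
    have p_odd: "odd p" using \<open>odd m\<close> m_eq by auto
    have p3: "p > 2" using p p_odd prime_ge_2_nat[of p] by (cases "p = 2") auto
    \<comment> \<open>A prime factor of \<open>k\<close> is below \<open>p\<close>, while one of
      \<open>d\<close> divides \<open>m\<close> and so is at least \<open>p\<close>.\<close>
    have cop: "coprime k d" if k: "0 < k" "k < p" for k
    proof (rule ccontr)
      assume "\<not> coprime k d"
      hence "gcd k d \<noteq> 1" by (simp only: coprime_iff_gcd_eq_1 not_False_eq_True)
      then obtain q where q: "prime q" "q dvd k" "q dvd d"
        using prime_factor_nat[of "gcd k d"] by auto
      have "q \<le> k" using q k by (intro dvd_imp_le) auto
      moreover have "p \<le> q" using q dm by (intro p_least) (auto intro: dvd_trans)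
      ultimately show False using k by simp
    qed
    have "p \<le> d"
    proof -
      obtain q where q: "prime q" "q dvd d" using d prime_factor_nat[of d] by auto
      have "p \<le> q" using q dm by (intro p_least) (auto intro: dvd_trans)
      also have "q \<le> d" using q d by (intro dvd_imp_le) auto
      finally show ?thesis .
    qed
    \<comment> \<open>By \<open>cop\<close>, the numbers from 1 to \<open>p - 1\<close> are
      totatives of \<open>d\<close>; \<open>p \<le> d\<close> keeps them in range.\<close>
    have tot: "p - 1 \<le> totient d"
    proof -
      have "{0<..<p} \<subseteq> totatives d" using cop \<open>p \<le> d\<close> by (auto simp: in_totatives_iff)
      hence "card {0<..<p} \<le> totient d" unfolding totient_def by (intro card_mono) auto
      thus ?thesis by simp
    qed
    have "cyclotomic_value M d dvd (M ^ d - 1) div (M ^ 1 - 1)"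
      using d by (intro cyclotomic_value_dvd[OF M]) auto
    also have "\<dots> dvd (M ^ m - 1) div (M ^ 1 - 1)"
      using M dm by (intro div_dvd_div[THEN iffD2] power_minus_one_dvd_power_minus_one) auto
    finally have cv: "cyclotomic_value M d dvd (M ^ m - 1) div (M - 1)" by simp
    have "m div d = p" using d by (simp add: m_eq)
    with prod_power_plus_one_cong_cyclotomic_value[OF M \<open>odd m\<close> dm]
    have "[(\<Prod>j\<in>{0<..<m}. M ^ j + 1) = 2 ^ (p - 1)] (mod cyclotomic_value M d)" by simp
    moreover have "[(\<Prod>j\<in>{0<..<m}. M ^ j + 1) = 1] (mod cyclotomic_value M d)"
      using cong cv by (rule cong_dvd_modulus_nat)
    ultimately have two: "[2 ^ (p - 1) = 1] (mod cyclotomic_value M d)"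
      by (meson cong_sym cong_trans)
    have gt: "cyclotomic_value M d > (M - 1) ^ totient d"
      by (rule cyclotomic_value_gt[OF M d])
    show False
    proof (cases "M = 2")
      case True
      have "cyclotomic_value M d dvd 2 ^ d - 1"
        using prod_cyclotomic_value[of M d] d M True dvd_prodI[of "{e. e dvd d}" d "cyclotomic_value M"] by simp
      moreover have "cyclotomic_value M d dvd 2 ^ (p - 1) - 1"
        using two by (simp add: dvd_power_minus_one_iff ord_divides del: One_nat_def)
      ultimately have "cyclotomic_value M d dvd 2 ^ gcd (p - 1) d - 1"
        using gcd_power_minus_one[of 2 "p - 1" d] by (metis gcd_greatest zero_less_numeral)
      \<comment> \<open>So the value divides \<open>2 ^ 1 - 1 = 1\<close>, whereas \<open>gt\<close>
        with \<open>M - 1 = 1\<close> makes it exceed 1.\<close>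
      moreover have "gcd (p - 1) d = 1" using cop[of "p - 1"] p3 by simp
      ultimately show False using gt True by simp
    next
      case False
      have "cyclotomic_value M d dvd 2 ^ (p - 1) - 1"
        using two by (simp add: dvd_power_minus_one_iff ord_divides del: One_nat_def)
      hence "cyclotomic_value M d \<le> 2 ^ (p - 1) - 1"
        using p3 one_less_power[of "2::nat" "p - 1"] by (intro dvd_imp_le) auto
      also have "\<dots> < 2 ^ (p - 1)" by simp
      also have "\<dots> \<le> 2 ^ totient d" using tot by (intro power_increasing) auto
      also have "\<dots> \<le> (M - 1) ^ totient d" using M False by (intro power_mono) auto
      finally show False using gt by simp
    qed
  qed
qed

end
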